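(* Let $k\ge 1$, $r\ge 1$ and $a_1\ge a_2\ge\cdots\ge a_r\ge 3$ be integers. Then $$\chi_{la}(H(a_1,a_2,\ldots,a_r;k))=\begin{cases}3 & \text{if } k=1,\\ k+1 & \text{if } k\ge 2.\end{cases}$$
   Context: A local antimagic labeling of a connected graph $G=(V,E)$ is a bijection $f:E\to\{1,\dots,|E|\}$ such that, with $f^+(u)=\sum f(e)$ (sum over all edges $e$ incident to $u$), one has $f^+(u)\neq f^+(v)$ for every pair of adjacent vertices $u,v$. The color number $c(f)$ is the number of distinct values of $f^+$ on $V$. The local antimagic chromatic number $\chi_{la}(G)$ is the minimum of $c(f)$ over all local antimagic labelings $f$ of $G$. For $k,r\ge 1$ and $a_1\ge\cdots\ge a_r\ge 3$, the hibiscus graph $H(a_1,\ldots,a_r;k)$ is obtained as follows: take disjoint cycles of orders $a_1,\ldots,a_r$, choose one vertex in each and identify these chosen vertices into a single vertex $u$ (for $r=1$ this is just the cycle $C_{a_1}$ with a chosen vertex $u$); then attach $k$ new pendant (degree-one) vertices, each joined by an edge to $u$. *)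

theory Defs
  imports Main
begin

section \<open>Finite simple graphs and local antimagic labelings\<close>

text \<open>An undirected graph is a pair of a vertex set and a set of edges, each edge being the
  two-element set of its endpoints.\<close>

type_synonym 'v ugraph = "'v set \<times> 'v set set"

abbreviation verts :: "'v ugraph \<Rightarrow> 'v set" where "verts G \<equiv> fst G"
abbreviation edges :: "'v ugraph \<Rightarrow> 'v set set" where "edges G \<equiv> snd G"

definition simple_graph :: "'v ugraph \<Rightarrow> bool" where
  "simple_graph G \<longleftrightarrow> finite (verts G) \<and> (\<forall>e\<in>edges G. e \<subseteq> verts G \<and> card e = 2)"

definition adjacent :: "'v ugraph \<Rightarrow> 'v \<Rightarrow> 'v \<Rightarrow> bool" where
  "adjacent G u v \<longleftrightarrow> u \<noteq> v \<and> {u, v} \<in> edges G"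

definition connected_graph :: "'v ugraph \<Rightarrow> bool" where
  "connected_graph G \<longleftrightarrow> simple_graph G \<and> verts G \<noteq> {} \<and>
     (\<forall>u\<in>verts G. \<forall>v\<in>verts G. (adjacent G)\<^sup>*\<^sup>* u v)"

definition induced_color :: "'v ugraph \<Rightarrow> ('v set \<Rightarrow> nat) \<Rightarrow> 'v \<Rightarrow> nat" where
  "induced_color G f u = (\<Sum>e\<in>{e \<in> edges G. u \<in> e}. f e)"

definition local_antimagic_labeling :: "'v ugraph \<Rightarrow> ('v set \<Rightarrow> nat) \<Rightarrow> bool" where
  "local_antimagic_labeling G f \<longleftrightarrow> connected_graph G \<and>
     bij_betw f (edges G) {1..card (edges G)} \<and>
     (\<forall>u v. adjacent G u v \<longrightarrow> induced_color G f u \<noteq> induced_color G f v)"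

definition color_number :: "'v ugraph \<Rightarrow> ('v set \<Rightarrow> nat) \<Rightarrow> nat" where
  "color_number G f = card (induced_color G f ` verts G)"

text \<open>On \<open>nat\<close>, \<open>Inf\<close> of a nonempty set is its minimum. If \<open>G\<close> has no local antimagic
  labeling, the value is the junk value \<open>0\<close>, which is never a color number of a graph
  with a vertex.\<close>

definition chi_la :: "'v ugraph \<Rightarrow> nat" where
  "chi_la G = Inf {color_number G f | f. local_antimagic_labeling G f}"


section \<open>Hibiscus graphs\<close>

datatype hvertex = Center | Petal nat nat | Pendant nat

definition cycle_edges :: "nat \<Rightarrow> nat set set" where
  "cycle_edges n = {{j, (j + 1) mod n} | j. j < n}"

text \<open>The \<open>i\<close>-th cycle lives on \<open>{0..<a i}\<close>. Position \<open>0\<close> is its chosen vertex (cycles are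
  vertex-transitive, so the choice is immaterial); \<open>glue i\<close> identifies it with the common
  vertex \<open>Center\<close> and keeps the remaining vertices of different cycles apart.\<close>

definition glue :: "nat \<Rightarrow> nat \<Rightarrow> hvertex" where
  "glue i j = (if j = 0 then Center else Petal i j)"

definition hibiscus :: "nat \<Rightarrow> (nat \<Rightarrow> nat) \<Rightarrow> nat \<Rightarrow> hvertex ugraph" where
  "hibiscus r a k =
     ((\<Union>i\<in>{1..r}. glue i ` {0..<a i}) \<union> Pendant ` {1..k},
      (\<Union>i\<in>{1..r}. (\<lambda>e. glue i ` e) ` cycle_edges (a i)) \<union> {{Center, Pendant p} | p. p \<in> {1..k}})"

lemma glue_inj: "inj (glue i)"
  by (auto simp: inj_def glue_def split: if_splits)

lemma succ_mod_neq:
  fixes j n :: nat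
  assumes "j < n" "n \<ge> 3"
  shows "(j + 1) mod n \<noteq> j"
  using assms by (cases "Suc j = n") auto

lemma simple_graph_hibiscus:
  assumes "r \<ge> 1" and a: "\<And>i. i \<in> {1..r} \<Longrightarrow> a i \<ge> 3"
  shows "simple_graph (hibiscus r a k)"
  unfolding simple_graph_def
proof (intro conjI ballI)
  show "finite (verts (hibiscus r a k))" by (simp add: hibiscus_def)
next
  have cen: "Center \<in> (\<Union>i\<in>{1..r}. glue i ` {0..<a i})"
    using assms(1) a[of 1] by (force simp: glue_def)
  fix e assume "e \<in> edges (hibiscus r a k)"
  then consider i j where "i \<in> {1..r}" "j < a i" "e = glue i ` {j, (j + 1) mod a i}"
    | p where "p \<in> {1..k}" "e = {Center, Pendant p}"
    by (auto simp: hibiscus_def cycle_edges_def)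
  then have "e \<subseteq> verts (hibiscus r a k) \<and> card e = 2"
  proof cases
    case 1
    have "(j + 1) mod a i < a i" using a[OF 1(1)] by simp
    then have "{j, (j + 1) mod a i} \<subseteq> {0..<a i}" using 1(2) by auto
    then have "e \<subseteq> verts (hibiscus r a k)" using 1 by (fastforce simp: hibiscus_def)
    moreover have "card e = 2"
      unfolding 1(3) using succ_mod_neq[OF 1(2) a[OF 1(1)]]
      by (subst card_image[OF inj_on_subset[OF glue_inj subset_UNIV]]) auto
    ultimately show ?thesis by blast
  next
    case 2
    then show ?thesis using cen by (auto simp: hibiscus_def)
  qed
  then show "e \<subseteq> verts (hibiscus r a k)" "card e = 2" by auto
qed

lemma connected_graph_hibiscus:
  assumes "r \<ge> 1" and a: "\<And>i. i \<in> {1..r} \<Longrightarrow> a i \<ge> 3"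
  shows "connected_graph (hibiscus r a k)"
proof -
  let ?G = "hibiscus r a k"
  have sym: "symp (adjacent ?G)\<^sup>*\<^sup>*"
    by (intro symp_rtranclp) (auto simp: symp_def adjacent_def insert_commute)
  have step: "adjacent ?G (glue i j) (glue i (Suc j))"
    if "i \<in> {1..r}" "Suc j < a i" for i j
  proof -
    have "{j, Suc j} \<in> cycle_edges (a i)"
      using that by (auto simp: cycle_edges_def intro!: exI[of _ j])
    then have "glue i ` {j, Suc j} \<in> edges ?G"
      using that(1) unfolding hibiscus_def snd_conv by blast
    then have "{glue i j, glue i (Suc j)} \<in> edges ?G" by (simp only: image_insert image_empty)
    moreover have "glue i j \<noteq> glue i (Suc j)" by (simp add: glue_def)
    ultimately show ?thesis by (simp add: adjacent_def)
  qed
  have cyc: "(adjacent ?G)\<^sup>*\<^sup>* Center (glue i j)" if "i \<in> {1..r}" "j < a i" for i j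
    using that(2)
  proof (induction j)
    case 0
    then show ?case by (simp add: glue_def)
  next
    case (Suc j)
    then show ?case using step[OF that(1) Suc.prems] by (auto intro: rtranclp.rtrancl_into_rtrancl)
  qed
  have pend: "(adjacent ?G)\<^sup>*\<^sup>* Center (Pendant p)" if "p \<in> {1..k}" for p
    using that by (intro r_into_rtranclp) (auto simp: adjacent_def hibiscus_def)
  have reach: "(adjacent ?G)\<^sup>*\<^sup>* Center v" if "v \<in> verts ?G" for v
    using that cyc pend by (auto simp: hibiscus_def)
  have "(adjacent ?G)\<^sup>*\<^sup>* u v" if "u \<in> verts ?G" "v \<in> verts ?G" for u v
    using reach[OF that(1)] reach[OF that(2)] sympD[OF sym] by (meson rtranclp_trans)
  moreover have "verts ?G \<noteq> {}"
    using assms(1) a[of 1] by (force simp: hibiscus_def)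
  ultimately show ?thesis
    using simple_graph_hibiscus[OF assms] by (simp add: connected_graph_def)
qed

end

theory Submission
  imports Defs
begin

text \<open>For \<open>k \<ge> 2\<close> the lower bound is immediate: the pendant vertices have distinct colors, all
  smaller than that of the center. If \<open>k = 1\<close> and only two colors occur, every edge joins the
  two color classes. The edge with the largest label \<open>m\<close> has an end of the pendant's color, which
  is at most \<open>m\<close>, so the pendant edge has label \<open>m\<close>. Let \<open>m + d\<close> be the color of the center, so
  that \<open>d \<ge> 3\<close>. An edge with label at most \<open>d\<close> must meet the center, as otherwise
  its end of color \<open>m + d\<close> would have a second edge with label at least \<open>m\<close>. Hence the
  center meets the edges with labels \<open>1\<close>, \<open>d\<close> and \<open>m\<close> (or all edges, if \<open>d \<ge> m\<close>), which is too much.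

  For the upper bound, run through the cycles one after another, starting and ending at the
  center, and give the \<open>A\<close> edges of this Euler tour the labels \<open>1, A, 2, A - 1, \<dots>\<close>. The inner vertices
  of the cycles then alternate between the colors \<open>A + 1\<close> and \<open>A + 2\<close>; with \<open>A + 1, \<dots>, A + k\<close> on the
  pendant edges, these are colors of pendant vertices as well, as far as \<open>k\<close> permits.\<close>

section \<open>Edges of a hibiscus graph\<close>

definition petal_edge :: "(nat \<Rightarrow> nat) \<Rightarrow> nat \<Rightarrow> nat \<Rightarrow> hvertex set" where
  "petal_edge a i j = {glue i j, glue i ((j + 1) mod a i)}"

definition pendant_edge :: "nat \<Rightarrow> hvertex set" where
  "pendant_edge p = {Center, Pendant p}"

lemma edges_hibiscus:
  "edges (hibiscus r a k) =
    (\<Union>i\<in>{1..r}. petal_edge a i ` {..<a i}) \<union> pendant_edge ` {1..k}"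
proof -
  have "(\<lambda>e. glue i ` e) ` cycle_edges (a i) = petal_edge a i ` {..<a i}" for i
    unfolding cycle_edges_def petal_edge_def setcompr_eq_image image_image
    by (simp add: lessThan_def)
  moreover have "{{Center, Pendant p} | p. p \<in> {1..k}} = pendant_edge ` {1..k}"
    unfolding pendant_edge_def by auto
  ultimately show ?thesis
    unfolding hibiscus_def by (simp only: snd_conv)
qed

lemma finite_edges_hibiscus: "finite (edges (hibiscus r a k))"
  by (simp add: hibiscus_def cycle_edges_def)

lemma petal_edge_eq:
  assumes "j < a i"
  shows "petal_edge a i j =
    {if j = 0 then Center else Petal i j, if Suc j = a i then Center else Petal i (Suc j)}"
  using assms by (auto simp: petal_edge_def glue_def)

text \<open>Comparing endpoints settles every case. Length at least 3 matters: in a 2-cycle, edges 0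
  and 1 would both be \<open>{Center, Petal i 1}\<close>.\<close>

lemma petal_edge_inject:
  assumes "i \<in> I" "i' \<in> I" and I: "\<forall>i\<in>I. a i \<ge> 3"
    and j: "j < a i" "j' < a i'" and eq: "petal_edge a i j = petal_edge a i' j'"
  shows "i = i' \<and> j = j'"
proof -
  \<comment> \<open>With the lengths replaced by variables, linked only by
    \<open>i = i' \<Longrightarrow> m = n\<close>, each endpoint case reduces to linear
    arithmetic.\<close>
  obtain m n where mn: "m = a i" "n = a i'" by blast
  have "m \<ge> 3" "n \<ge> 3" using assms(1,2) I mn by auto
  moreover have "{if j = 0 then Center else Petal i j, if Suc j = m then Center else Petal i (Suc j)} =
    {if j' = 0 then Center else Petal i' j', if Suc j' = n then Center else Petal i' (Suc j')}"
    using eq unfolding petal_edge_eq[of j a, OF j(1)] petal_edge_eq[of j' a, OF j(2)] mn .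
  moreover have "i = i' \<Longrightarrow> m = n" using mn by simp
  ultimately show ?thesis
    by (cases "j = 0"; cases "Suc j = m"; cases "j' = 0"; cases "Suc j' = n")
      (simp_all add: doubleton_eq_iff, linarith+)
qed

lemma petal_edge_neq_pendant_edge: "petal_edge a i j \<noteq> pendant_edge p"
  by (auto simp: petal_edge_def pendant_edge_def glue_def doubleton_eq_iff)

lemma pendant_edge_inject: "pendant_edge p = pendant_edge q \<longleftrightarrow> p = q"
  by (auto simp: pendant_edge_def doubleton_eq_iff)

lemma pendant_edge_in_edges: "p \<in> {1..k} \<Longrightarrow> pendant_edge p \<in> edges (hibiscus r a k)"
  by (simp add: edges_hibiscus)

lemma petal_edge_in_edges:
  "i \<in> {1..r} \<Longrightarrow> j < a i \<Longrightarrow> petal_edge a i j \<in> edges (hibiscus r a k)"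
  unfolding edges_hibiscus by blast

lemma hibiscus_edge_cases:
  assumes "e \<in> edges (hibiscus r a k)"
  obtains (petal) i j where "i \<in> {1..r}" "j < a i" "e = petal_edge a i j"
    | (pendant) p where "p \<in> {1..k}" "e = pendant_edge p"
  using assms unfolding edges_hibiscus by blast

section \<open>Induced colors of pendant vertices, cycle vertices and the center\<close>

lemma sum_le_induced_color:
  assumes "finite (edges G)" "S \<subseteq> edges G" "\<And>e. e \<in> S \<Longrightarrow> u \<in> e"
  shows "sum f S \<le> induced_color G f u"
  unfolding induced_color_def using assms by (intro sum_mono2) auto

lemma induced_color_Pendant:
  assumes "p \<in> {1..k}"
  shows "induced_color (hibiscus r a k) f (Pendant p) = f (pendant_edge p)"
proof -
  have "{e \<in> edges (hibiscus r a k). Pendant p \<in> e} = {pendant_edge p}"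
    using assms by (auto simp: edges_hibiscus petal_edge_def pendant_edge_def glue_def split: if_splits)
  then show ?thesis by (simp add: induced_color_def)
qed

context
  fixes r :: nat and a :: "nat \<Rightarrow> nat"
  assumes r_ge: "r \<ge> 1" and a_ge: "\<forall>i\<in>{1..r}. a i \<ge> 3"
begin

lemma verts_hibiscus:
  "verts (hibiscus r a k) =
    {Center} \<union> {Petal i j | i j. i \<in> {1..r} \<and> 1 \<le> j \<and> j < a i} \<union> Pendant ` {1..k}"
proof -
  have "glue i ` {0..<a i} = {Center} \<union> {Petal i j | j. 1 \<le> j \<and> j < a i}"
    if "i \<in> {1..r}" for i
  proof -
    have "{0..<a i} = insert 0 {1..<a i}" using a_ge that by force
    then show ?thesis by (auto simp: glue_def)
  qed
  then have "(\<Union>i\<in>{1..r}. glue i ` {0..<a i}) =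
      (\<Union>i\<in>{1..r}. {Center} \<union> {Petal i j | j. 1 \<le> j \<and> j < a i})"
    by simp
  also have "\<dots> = {Center} \<union> {Petal i j | i j. i \<in> {1..r} \<and> 1 \<le> j \<and> j < a i}"
    using r_ge by auto
  finally show ?thesis
    unfolding hibiscus_def by simp
qed

lemma finite_verts_hibiscus: "finite (verts (hibiscus r a k))"
  by (simp add: hibiscus_def)

lemma edges_at_Petal:
  assumes "i \<in> {1..r}" "1 \<le> j" "j < a i"
  shows "{e \<in> edges (hibiscus r a k). Petal i j \<in> e} =
    {petal_edge a i (j - 1), petal_edge a i j}"
proof -
  have j': "j - 1 < a i" "Suc (j - 1) = j" using assms by auto
  have "e \<in> {petal_edge a i (j - 1), petal_edge a i j}"
    if "e \<in> edges (hibiscus r a k)" "Petal i j \<in> e" for e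
    using that(1)
  proof (cases rule: hibiscus_edge_cases)
    case (petal i' j')
    then have "i = i' \<and> (j = j' \<or> j = Suc j')"
      using that(2) by (auto simp: petal_edge_eq split: if_splits)
    then show ?thesis using petal by auto
  next
    case (pendant p)
    then show ?thesis using that(2) by (simp add: pendant_edge_def)
  qed
  moreover have "petal_edge a i (j - 1) \<in> edges (hibiscus r a k)"
    "petal_edge a i j \<in> edges (hibiscus r a k)"
    using assms j' by (auto intro!: petal_edge_in_edges)
  moreover have "Petal i j \<in> petal_edge a i (j - 1)" "Petal i j \<in> petal_edge a i j"
    using assms j' by (auto simp: petal_edge_eq)
  ultimately show ?thesis by blast
qed

lemma induced_color_Petal:
  assumes "i \<in> {1..r}" "1 \<le> j" "j < a i"
  shows "induced_color (hibiscus r a k) f (Petal i j) =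
    f (petal_edge a i (j - 1)) + f (petal_edge a i j)"
proof -
  have "petal_edge a i (j - 1) \<noteq> petal_edge a i j"
    using petal_edge_inject[OF assms(1) assms(1) a_ge less_imp_diff_less[OF assms(3), of 1] assms(3)]
      assms(2) by auto
  then show ?thesis by (simp add: induced_color_def edges_at_Petal[OF assms])
qed

text \<open>A lower bound on the center's color is enough throughout. Cycle 1 exists as
  \<open>r \<ge> 1\<close>, and its first and last edges, distinct as \<open>a 1 \<ge> 3\<close>,
  both meet the center.\<close>

lemma induced_color_Center_ge:
  assumes "S \<subseteq> {1..k}"
  shows "(\<Sum>p\<in>S. f (pendant_edge p)) + f (petal_edge a 1 0) + f (petal_edge a 1 (a 1 - 1))
    \<le> induced_color (hibiscus r a k) f Center"
proof -
  let ?P = "{petal_edge a 1 0, petal_edge a 1 (a 1 - 1)}"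
  have one: "1 \<in> {1..r}" using r_ge by simp
  then have a1: "a 1 \<ge> 3" using a_ge by blast
  then have lt: "0 < a 1" "a 1 - 1 < a 1" by auto
  have "finite S" using assms finite_subset by blast
  moreover have "petal_edge a 1 0 \<noteq> petal_edge a 1 (a 1 - 1)"
    using petal_edge_inject[OF one one a_ge lt] a1 by auto
  moreover have "pendant_edge ` S \<inter> ?P = {}"
    by (auto simp: petal_edge_neq_pendant_edge)
  ultimately have "sum f (pendant_edge ` S \<union> ?P) =
      (\<Sum>p\<in>S. f (pendant_edge p)) + f (petal_edge a 1 0) + f (petal_edge a 1 (a 1 - 1))"
    by (simp add: sum.union_disjoint sum.reindex inj_on_def pendant_edge_inject)
  moreover have "sum f (pendant_edge ` S \<union> ?P) \<le> induced_color (hibiscus r a k) f Center"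
  proof (rule sum_le_induced_color[OF finite_edges_hibiscus])
    show "pendant_edge ` S \<union> ?P \<subseteq> edges (hibiscus r a k)"
      using assms pendant_edge_in_edges petal_edge_in_edges[of _ r _ a, OF one] lt by fast
  next
    fix e assume "e \<in> pendant_edge ` S \<union> ?P"
    then show "Center \<in> e" using lt by (auto simp: pendant_edge_def petal_edge_eq)
  qed
  ultimately show ?thesis by simp
qed

text \<open>The center meets the same pendant edge and also a cycle edge with a positive
  label.\<close>

lemma induced_color_Pendant_less_Center:
  assumes "p \<in> {1..k}" and "\<And>e. e \<in> edges (hibiscus r a k) \<Longrightarrow> f e \<ge> 1"
  shows "induced_color (hibiscus r a k) f (Pendant p) < induced_color (hibiscus r a k) f Center"
proof -
  have "1 \<in> {1..r}" using r_ge by simp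
  moreover from this have "0 < a 1" using a_ge by fastforce
  ultimately have "1 \<le> f (petal_edge a 1 0)" using assms(2) petal_edge_in_edges by blast
  then show ?thesis
    using induced_color_Center_ge[of "{p}" k f] assms(1) induced_color_Pendant[of p k r a f] by simp
qed

section \<open>Lower bounds on the number of colors\<close>

lemma color_number_hibiscus_ge:
  assumes f: "local_antimagic_labeling (hibiscus r a k) f"
  shows "color_number (hibiscus r a k) f \<ge> k + 1"
proof -
  let ?G = "hibiscus r a k"
  let ?c = "induced_color ?G f"
  have bij: "bij_betw f (edges ?G) {1..card (edges ?G)}"
    using f by (simp add: local_antimagic_labeling_def)
  then have less: "?c (Pendant p) < ?c Center" if "p \<in> {1..k}" for p
    using bij_betwE by (intro induced_color_Pendant_less_Center[OF that]) force
  have "inj_on f (edges ?G)" using bij bij_betw_def by blast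
  then have "inj_on (\<lambda>p. ?c (Pendant p)) {1..k}"
    unfolding inj_on_def by (metis induced_color_Pendant pendant_edge_in_edges pendant_edge_inject)
  then have "card ((\<lambda>p. ?c (Pendant p)) ` {1..k}) = k"
    by (simp add: card_image)
  moreover have "?c Center \<notin> (\<lambda>p. ?c (Pendant p)) ` {1..k}" using less by fastforce
  ultimately have "card (insert (?c Center) ((\<lambda>p. ?c (Pendant p)) ` {1..k})) = k + 1" by simp
  moreover have "insert (?c Center) ((\<lambda>p. ?c (Pendant p)) ` {1..k}) \<subseteq> ?c ` verts ?G"
    unfolding verts_hibiscus by blast
  ultimately show ?thesis
    unfolding color_number_def by (metis card_mono finite_imageI finite_verts_hibiscus)
qed

lemma color_number_hibiscus_1_ge:
  assumes f: "local_antimagic_labeling (hibiscus r a 1) f"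
  shows "color_number (hibiscus r a 1) f \<ge> 3"
proof (rule ccontr)
  let ?G = "hibiscus r a 1"
  let ?c = "induced_color ?G f"
  define m where "m = card (edges ?G)"
  define x where "x = f (pendant_edge 1)"
  define y where "y = ?c Center"
  assume "\<not> color_number ?G f \<ge> 3"
  then have card2: "card (?c ` verts ?G) = 2"
    using color_number_hibiscus_ge[OF f] by (simp add: color_number_def)
  have bij: "bij_betw f (edges ?G) {1..m}"
    and proper: "\<And>u v. adjacent ?G u v \<Longrightarrow> ?c u \<noteq> ?c v"
    using f by (auto simp: local_antimagic_labeling_def m_def)
  have inj: "e = e'" if "e \<in> edges ?G" "e' \<in> edges ?G" "f e = f e'" for e e'
    using bij that unfolding bij_betw_def inj_on_def by blast
  have range: "1 \<le> f e \<and> f e \<le> m" if "e \<in> edges ?G" for e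
    using bij_betwE[OF bij] that by fastforce
  have ex_label: "\<exists>e\<in>edges ?G. f e = t" if "1 \<le> t" "t \<le> m" for t
  proof -
    have "t \<in> f ` edges ?G" using bij that unfolding bij_betw_def by simp
    then show ?thesis by blast
  qed
  have pend: "pendant_edge 1 \<in> edges ?G" by (intro pendant_edge_in_edges) simp
  have c_pend: "?c (Pendant 1) = x" unfolding x_def by (intro induced_color_Pendant) simp
  have "x < y"
    unfolding y_def c_pend[symmetric] using range by (intro induced_color_Pendant_less_Center) auto
  moreover have sub: "{x, y} \<subseteq> ?c ` verts ?G"
    unfolding verts_hibiscus y_def c_pend[symmetric] by auto
  ultimately have colors: "?c ` verts ?G = {x, y}"
    using card2 by (intro card_subset_eq[symmetric]) (auto simp: finite_verts_hibiscus)
  \<comment> \<open>Adjacent vertices differ in color and only \<open>x\<close> and \<open>y\<close>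
    are available, so every edge has one end of each color.\<close>
  have ends: "(\<exists>v\<in>e. v \<in> verts ?G \<and> ?c v = x) \<and> (\<exists>v\<in>e. v \<in> verts ?G \<and> ?c v = y)" if e: "e \<in> edges ?G" for e
  proof -
    have "simple_graph ?G"
      using f by (simp add: local_antimagic_labeling_def connected_graph_def)
    then have "e \<subseteq> verts ?G" "card e = 2" using e by (auto simp: simple_graph_def)
    then obtain u v where uv: "e = {u, v}" "u \<noteq> v" "u \<in> verts ?G" "v \<in> verts ?G"
      by (auto simp: card_2_iff)
    then have "?c u \<noteq> ?c v" using e by (intro proper) (simp add: adjacent_def)
    moreover have "?c u \<in> {x, y}" "?c v \<in> {x, y}" using uv colors by blast+
    ultimately show ?thesis using uv by auto
  qed
  have le_color: "f e \<le> ?c v" if "e \<in> edges ?G" "v \<in> e" for e v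
    using sum_le_induced_color[OF finite_edges_hibiscus, of "{e}"] that by simp
  have "m \<ge> 1" using range[OF pend] by linarith
  then obtain e\<^sub>m where em: "e\<^sub>m \<in> edges ?G" "f e\<^sub>m = m" using ex_label[of m] by blast
  \<comment> \<open>The end of color \<open>x\<close> of the edge labeled \<open>m\<close> has color
    at least \<open>m\<close>, while \<open>x\<close> is itself a label.\<close>
  then have "m \<le> x" using ends[OF em(1)] le_color[OF em(1)] by auto
  then have xm: "x = m" using range[OF pend] by (simp add: x_def)
  then have em_pend: "e\<^sub>m = pendant_edge 1" using inj[OF em(1) pend] em(2) by (simp add: x_def)
  have one: "1 \<in> {1..r}" using r_ge by simp
  then have a1: "a 1 \<ge> 3" using a_ge by blast
  have petals: "petal_edge a 1 0 \<in> edges ?G" "petal_edge a 1 (a 1 - 1) \<in> edges ?G"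
    "petal_edge a 1 1 \<in> edges ?G"
    by (intro petal_edge_in_edges one; use a1 in linarith)+
  have "petal_edge a 1 0 \<noteq> petal_edge a 1 (a 1 - 1)"
    using petal_edge_inject[OF one one a_ge, of 0 "a 1 - 1"] a1 by auto
  then have "f (petal_edge a 1 0) \<noteq> f (petal_edge a 1 (a 1 - 1))" using inj petals by blast
  \<comment> \<open>Two distinct positive labels sum to at least 1 + 2; this is the source of
    \<open>d \<ge> 3\<close>.\<close>
  then have "f (petal_edge a 1 0) + f (petal_edge a 1 (a 1 - 1)) \<ge> 3"
    using range[OF petals(1)] range[OF petals(2)] by linarith
  moreover have "x + f (petal_edge a 1 0) + f (petal_edge a 1 (a 1 - 1)) \<le> y"
    using induced_color_Center_ge[of "{1}" 1 f] by (simp add: x_def y_def)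
  ultimately obtain d where d: "y = m + d" "d \<ge> 3"
    using xm by (metis add.assoc add_le_cancel_left le_iff_add order_trans)
  have at_Center: "Center \<in> e" if e: "e \<in> edges ?G" and "f e \<le> d" for e
  proof (rule ccontr)
    assume nC: "Center \<notin> e"
    obtain v where v: "v \<in> e" "?c v = y" "v \<in> verts ?G" using ends[OF e] by blast
    then have "v \<noteq> Center" "v \<noteq> Pendant 1" using nC c_pend \<open>x < y\<close> by auto
    then obtain i j where ij: "v = Petal i j" "i \<in> {1..r}" "1 \<le> j" "j < a i"
      using v(3) unfolding verts_hibiscus by auto
    have "e \<in> {petal_edge a i (j - 1), petal_edge a i j}"
      using edges_at_Petal[OF ij(2-4), of 1] e v(1) ij(1) by blast
    moreover have "f (petal_edge a i (j - 1)) + f (petal_edge a i j) = y"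
      using induced_color_Petal[OF ij(2-4), of 1 f] v(2) ij(1) by simp
    moreover have "j - 1 < a i" using ij(4) by simp
    \<comment> \<open>The index \<open>l\<close> is whichever of \<open>j - 1\<close> and
      \<open>j\<close> does not give \<open>e\<close>.\<close>
    ultimately obtain l where l: "l < a i" "f e + f (petal_edge a i l) = y"
      using ij(4) by (metis add.commute insertE singletonD)
    have g: "petal_edge a i l \<in> edges ?G" using petal_edge_in_edges ij(2) l(1) by blast
    \<comment> \<open>The other label is \<open>m + d - f e\<close>, at least \<open>m\<close> and
      hence equal to \<open>m\<close>, but that label belongs to the pendant edge.\<close>
    have "f (petal_edge a i l) = m" using l(2) d(1) that(2) range[OF g] by linarith
    then have "petal_edge a i l = pendant_edge 1" using inj[OF g em(1)] em em_pend by simp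
    then show False using petal_edge_neq_pendant_edge by blast
  qed
  show False
  proof (cases "d \<ge> m")
    case True
    \<comment> \<open>Here every edge would meet the center, yet this one joins positions 1 and 2 of
      a cycle of length at least 3.\<close>
    then have "Center \<in> petal_edge a 1 1" using at_Center[OF petals(3)] range[OF petals(3)] by linarith
    then show False using a1 by (simp add: petal_edge_eq)
  next
    case False
    obtain e\<^sub>1 e\<^sub>d where e: "e\<^sub>1 \<in> edges ?G" "f e\<^sub>1 = 1" "e\<^sub>d \<in> edges ?G" "f e\<^sub>d = d"
      using ex_label[of 1] ex_label[of d] False d(2) by auto
    have "Center \<in> e\<^sub>1" "Center \<in> e\<^sub>d" using at_Center e d(2) by auto
    moreover have "Center \<in> e\<^sub>m" by (simp add: em_pend pendant_edge_def)
    \<comment> \<open>Since \<open>1 < d < m\<close>, three different edges contribute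
      \<open>1 + d + m\<close>, which exceeds \<open>y = m + d\<close>.\<close>
    ultimately have "sum f {e\<^sub>1, e\<^sub>d, e\<^sub>m} \<le> y"
      unfolding y_def using e em(1) by (intro sum_le_induced_color[OF finite_edges_hibiscus]) auto
    moreover have "e\<^sub>1 \<noteq> e\<^sub>d" "e\<^sub>1 \<noteq> e\<^sub>m" "e\<^sub>d \<noteq> e\<^sub>m" using e em(2) d False by auto
    ultimately show False using e em(2) d by simp
  qed
qed

end

section \<open>Labeling along an Euler tour of the cycles\<close>

definition tour_label :: "nat \<Rightarrow> nat \<Rightarrow> nat" where
  "tour_label A t = (if even t then t div 2 + 1 else A - t div 2)"

lemma tour_label_Suc:
  assumes "Suc t < A"
  shows "tour_label A t + tour_label A (Suc t) = (if even t then A + 1 else A + 2)"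
  using assms by (auto simp: tour_label_def elim!: evenE oddE)

text \<open>Even positions get labels at most (A+1)/2 and odd positions labels at least (A+2)/2, so
  the two monotone halves never clash. Surjectivity follows by counting.\<close>

lemma bij_betw_tour_label: "bij_betw (tour_label A) {..<A} {1..A}"
proof -
  have "inj_on (tour_label A) {..<A}"
  proof (rule inj_onI)
    fix s t assume "s \<in> {..<A}" "t \<in> {..<A}" "tour_label A s = tour_label A t"
    then show "s = t"
      by (cases "even s"; cases "even t") (auto simp: tour_label_def elim!: evenE oddE)
  qed
  moreover have "tour_label A ` {..<A} \<subseteq> {1..A}" by (auto simp: tour_label_def)
  ultimately show ?thesis
    unfolding bij_betw_def by (simp add: card_image card_subset_eq)
qed

text \<open>The number of edges traversed before the tour enters cycle \<open>i\<close>; edge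
  \<open>j\<close> of that cycle has tour position \<open>petal_offset a i + j\<close>, counted from
  0.\<close>

definition petal_offset :: "(nat \<Rightarrow> nat) \<Rightarrow> nat \<Rightarrow> nat" where
  "petal_offset a i = sum a {1..<i}"

lemma petal_offset_less:
  assumes "1 \<le> i" "i < i'" "j < a i"
  shows "petal_offset a i + j < petal_offset a i'"
proof -
  have "petal_offset a i + j < sum a {1..<Suc i}"
    using assms by (simp add: petal_offset_def)
  also have "\<dots> \<le> petal_offset a i'"
    unfolding petal_offset_def using assms by (intro sum_mono2) auto
  finally show ?thesis .
qed

lemma petal_position_less:
  assumes "i \<in> {1..r}" "j < a i"
  shows "petal_offset a i + j < sum a {1..r}"
  \<comment> \<open>The total length is the offset of a fictitious cycle
    \<open>Suc r\<close>.\<close>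
  using petal_offset_less[of i "Suc r" j a] assms
  by (simp add: petal_offset_def atLeastLessThanSuc_atLeastAtMost)

text \<open>Different cycles occupy disjoint blocks of positions, which gives injectivity; both sets
  have the same size.\<close>

lemma bij_betw_petal_position:
  "bij_betw (\<lambda>(i, j). petal_offset a i + j) (SIGMA i:{1..r}. {..<a i}) {..<sum a {1..r}}"
proof -
  let ?X = "SIGMA i:{1..r}. {..<a i}" and ?p = "\<lambda>(i, j). petal_offset a i + j"
  have "i = i' \<and> j = j'"
    if ij: "i \<in> {1..r}" "j < a i" "i' \<in> {1..r}" "j' < a i'"
      and eq: "petal_offset a i + j = petal_offset a i' + j'" for i j i' j'
  proof -
    have "\<not> i < i'" "\<not> i' < i"
      using petal_offset_less[of i i' j a] petal_offset_less[of i' i j' a] ij eq by auto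
    then show ?thesis using eq by simp
  qed
  then have "inj_on ?p ?X" unfolding inj_on_def by fastforce
  moreover have "?p ` ?X \<subseteq> {..<sum a {1..r}}" using petal_position_less by fastforce
  ultimately show ?thesis
    unfolding bij_betw_def by (simp add: card_image card_subset_eq)
qed

section \<open>Existence, properness and color count of the tour labeling\<close>

context
  fixes r :: nat and a :: "nat \<Rightarrow> nat"
  assumes r_ge: "r \<ge> 1" and a_ge: "\<forall>i\<in>{1..r}. a i \<ge> 3"
begin

lemma ex_tour_labeling:
  obtains f where "bij_betw f (edges (hibiscus r a k)) {1..sum a {1..r} + k}"
    and "\<And>i j. i \<in> {1..r} \<Longrightarrow> j < a i \<Longrightarrow>
      f (petal_edge a i j) = tour_label (sum a {1..r}) (petal_offset a i + j)"
    and "\<And>p. p \<in> {1..k} \<Longrightarrow> f (pendant_edge p) = sum a {1..r} + p"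
proof -
  define A where "A = sum a {1..r}"
  define X where "X = (SIGMA i:{1..r}. {..<a i})"
  define P where "P = (\<lambda>(i, j). petal_edge a i j)"
  define L where "L = tour_label A \<circ> (\<lambda>(i, j). petal_offset a i + j)"
  \<comment> \<open>Edges are sets, so their indices are recovered through \<open>inv_into\<close>.
    The cycle edges use the labels up to \<open>A\<close>, the pendant edges those above.\<close>
  define f where "f = (\<lambda>e. if e \<in> P ` X then (L \<circ> inv_into X P) e
    else ((+) A \<circ> inv_into {1..k} pendant_edge) e)"
  have "(\<Union>i\<in>{1..r}. petal_edge a i ` {..<a i}) = P ` X"
    unfolding P_def X_def by force
  then have edges: "edges (hibiscus r a k) = P ` X \<union> pendant_edge ` {1..k}"
    by (simp only: edges_hibiscus)
  have disj: "P ` X \<inter> pendant_edge ` {1..k} = {}"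
    unfolding P_def using petal_edge_neq_pendant_edge by fastforce
  have injP: "inj_on P X"
    unfolding P_def X_def by (rule inj_onI) (auto dest!: petal_edge_inject[OF _ _ a_ge, rotated 4])
  have injp: "inj_on pendant_edge {1..k}" by (simp add: inj_on_def pendant_edge_inject)
  have "bij_betw L X {1..A}"
    unfolding L_def X_def A_def
    by (rule bij_betw_trans[OF bij_betw_petal_position bij_betw_tour_label])
  then have "bij_betw (L \<circ> inv_into X P) (P ` X) {1..A}"
    using injP by (intro bij_betw_trans[OF bij_betw_inv_into]) (auto simp: bij_betw_def)
  then have f1: "bij_betw f (P ` X) {1..A}"
    by (rule bij_betw_cong[THEN iffD1, rotated]) (simp add: f_def)
  have "bij_betw ((+) A) {1..k} {A + 1..A + k}"
    by (simp add: bij_betw_def)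
  then have "bij_betw ((+) A \<circ> inv_into {1..k} pendant_edge) (pendant_edge ` {1..k}) {A + 1..A + k}"
    using injp by (intro bij_betw_trans[OF bij_betw_inv_into]) (auto simp: bij_betw_def)
  then have f2: "bij_betw f (pendant_edge ` {1..k}) {A + 1..A + k}"
    using disj by (subst bij_betw_cong[where g = "(+) A \<circ> inv_into {1..k} pendant_edge"]) (auto simp: f_def)
  have "{1..A + k} = {1..A} \<union> {A + 1..A + k}" by auto
  then have "bij_betw f (edges (hibiscus r a k)) {1..A + k}"
    using bij_betw_combine[OF f1 f2] by (simp add: edges)
  moreover have "f (petal_edge a i j) = tour_label A (petal_offset a i + j)"
    if "i \<in> {1..r}" "j < a i" for i j
  proof -
    have "(i, j) \<in> X" using that by (simp add: X_def)
    then have "f (P (i, j)) = L (i, j)" by (simp add: f_def injP)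
    then show ?thesis by (simp add: P_def L_def)
  qed
  moreover have "f (pendant_edge p) = A + p" if "p \<in> {1..k}" for p
  proof -
    have "pendant_edge p \<notin> P ` X" using disj that by blast
    then show ?thesis using that injp by (simp add: f_def)
  qed
  ultimately show ?thesis using that unfolding A_def by blast
qed

text \<open>The bound has \<open>max k 2\<close> because the cycles may use both
  \<open>A + 1\<close> and \<open>A + 2\<close> even when \<open>k = 1\<close> makes only the first
  a pendant color.\<close>

lemma ex_local_antimagic_labeling_hibiscus:
  assumes "k \<ge> 1"
  obtains f where "local_antimagic_labeling (hibiscus r a k) f"
    and "color_number (hibiscus r a k) f \<le> max k 2 + 1"
proof -
  let ?G = "hibiscus r a k"
  define A where "A = sum a {1..r}"
  obtain f where bij: "bij_betw f (edges ?G) {1..A + k}"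
    and f_petal: "\<And>i j. i \<in> {1..r} \<Longrightarrow> j < a i \<Longrightarrow>
      f (petal_edge a i j) = tour_label A (petal_offset a i + j)"
    and f_pendant: "\<And>p. p \<in> {1..k} \<Longrightarrow> f (pendant_edge p) = A + p"
    using ex_tour_labeling[of k] unfolding A_def by blast
  let ?c = "induced_color ?G f"
  \<comment> \<open>The parity is opposite to that in \<open>tour_label_Suc\<close>: the first of
    the two tour edges at \<open>Petal i j\<close> has position
    \<open>petal_offset a i + j - 1\<close>.\<close>
  have c_petal: "?c (Petal i j) = (if even (petal_offset a i + j) then A + 2 else A + 1)"
    if "i \<in> {1..r}" and j: "1 \<le> j" and "j < a i" for i j
  proof -
    obtain l where l: "j = Suc l" using j by (cases j) auto
    have "?c (Petal i j) = tour_label A (petal_offset a i + l) + tour_label A (Suc (petal_offset a i + l))"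
      using that l by (simp add: induced_color_Petal[OF r_ge a_ge] f_petal)
    also have "\<dots> = (if even (petal_offset a i + l) then A + 1 else A + 2)"
      using petal_position_less[of i r j a] that l by (intro tour_label_Suc) (simp add: A_def)
    finally show ?thesis by (simp add: l)
  qed
  have pos: "f e \<ge> 1" if "e \<in> edges ?G" for e
    using bij_betwE[OF bij] that by fastforce
  \<comment> \<open>The pendant edge labeled \<open>A + 1\<close> and two cycle edges with positive
    labels already give \<open>A + 3\<close>.\<close>
  have c_Center: "?c Center > A + 2"
  proof -
    have one: "1 \<in> {1..r}" using r_ge by simp
    then have "0 < a 1" "a 1 - 1 < a 1" using a_ge by fastforce+
    then have "f (petal_edge a 1 0) \<ge> 1" "f (petal_edge a 1 (a 1 - 1)) \<ge> 1"
      using pos petal_edge_in_edges one by blast+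
    then show ?thesis
      using induced_color_Center_ge[OF r_ge a_ge, of "{1}" k f] f_pendant[of 1] assms by simp
  qed
  have c_pendant: "?c (Pendant p) = A + p" if "p \<in> {1..k}" for p
    using induced_color_Pendant[OF that] f_pendant[OF that] by simp
  have proper: "?c u \<noteq> ?c v" if "adjacent ?G u v" for u v
  proof -
    have "{u, v} \<in> edges ?G" using that by (simp add: adjacent_def)
    then show ?thesis
    proof (cases rule: hibiscus_edge_cases)
      case (petal i j)
      have ai: "a i \<ge> 3" using petal(1) a_ge by blast
      \<comment> \<open>The first and last edges of a cycle join the center, of color above
        \<open>A + 2\<close>, to an inner vertex. Any other edge joins inner vertices at consecutive
        positions, where the parity changes.\<close>
      consider "j = 0" | "j \<ge> 1" "Suc j = a i" | "j \<ge> 1" "Suc j < a i"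
        using petal(2) by linarith
      then have "?c (if j = 0 then Center else Petal i j) \<noteq>
        ?c (if Suc j = a i then Center else Petal i (Suc j))"
      proof cases
        case 1
        then show ?thesis using c_petal[OF petal(1), of 1] c_Center ai by auto
      next
        case 2
        then show ?thesis using c_petal[OF petal(1), of j] c_Center by auto
      next
        case 3
        then show ?thesis using c_petal[OF petal(1), of j] c_petal[OF petal(1), of "Suc j"] by auto
      qed
      then show ?thesis
        using petal(3) unfolding petal_edge_eq[of j a, OF petal(2)] by (metis doubleton_eq_iff)
    next
      case (pendant p)
      have "?c (Pendant p) < ?c Center"
        using pos by (intro induced_color_Pendant_less_Center[OF r_ge a_ge pendant(1)])
      then show ?thesis using pendant(2) by (auto simp: pendant_edge_def doubleton_eq_iff)
    qed
  qed
  have "connected_graph ?G" using r_ge a_ge by (intro connected_graph_hibiscus) auto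
  moreover have "card (edges ?G) = A + k" using bij_betw_same_card[OF bij] by simp
  ultimately have "local_antimagic_labeling ?G f"
    using bij proper by (simp add: local_antimagic_labeling_def)
  moreover have "color_number ?G f \<le> max k 2 + 1"
  proof -
    have "?c v \<in> insert (?c Center) {A + 1..A + max k 2}" if "v \<in> verts ?G" for v
      using that c_petal c_pendant unfolding verts_hibiscus[OF r_ge a_ge] by auto
    then have "card (?c ` verts ?G) \<le> card (insert (?c Center) {A + 1..A + max k 2})"
      by (intro card_mono image_subsetI) auto
    also have "\<dots> \<le> max k 2 + 1"
      using card_insert_le_m1[of "max k 2 + 1" "{A + 1..A + max k 2}" "?c Center"] by simp
    finally show ?thesis by (simp add: color_number_def)
  qed
  ultimately show ?thesis using that by blast
qed

end

lemma chi_la_eqI: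
  assumes "local_antimagic_labeling G f" "color_number G f \<le> n"
    and "\<And>g. local_antimagic_labeling G g \<Longrightarrow> n \<le> color_number G g"
  shows "chi_la G = n"
  unfolding chi_la_def
proof (rule cInf_eq_minimum)
  have "color_number G f = n" using assms by (simp add: order_antisym)
  then show "n \<in> {color_number G f | f. local_antimagic_labeling G f}" using assms(1) by blast
qed (use assms(3) in auto)

theorem theorem2p6:
  fixes k r :: nat and a :: "nat \<Rightarrow> nat"
  assumes "k \<ge> 1" and "r \<ge> 1"
    and "\<forall>i j. 1 \<le> i \<and> i \<le> j \<and> j \<le> r \<longrightarrow> a i \<ge> a j"
    and "\<forall>i\<in>{1..r}. a i \<ge> 3"
  shows "chi_la (hibiscus r a k) = (if k = 1 then 3 else k + 1)"
proof -
  obtain f where f: "local_antimagic_labeling (hibiscus r a k) f"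
    "color_number (hibiscus r a k) f \<le> max k 2 + 1"
    using ex_local_antimagic_labeling_hibiscus[OF assms(2,4,1)] .
  show ?thesis
  proof (rule chi_la_eqI[OF f(1)])
    \<comment> \<open>For \<open>k \<ge> 1\<close>, \<open>max k 2 + 1\<close> is exactly this case
      distinction.\<close>
    show "color_number (hibiscus r a k) f \<le> (if k = 1 then 3 else k + 1)"
      using f(2) assms(1) by (auto simp: max_def split: if_splits)
  next
    fix g assume "local_antimagic_labeling (hibiscus r a k) g"
    then show "(if k = 1 then 3 else k + 1) \<le> color_number (hibiscus r a k) g"
      using color_number_hibiscus_ge[OF assms(2,4)] color_number_hibiscus_1_ge[OF assms(2,4)] by auto
  qed
qed

end
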